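(* Let $T>\ell_0>0$, and let $(\ell,y)$ be a $C^{0,1}$-solution or a $C^1$-solution on $[0,T]$ of the debonding system with data $(\ell_0,y_0,y_1)$ and control $u$. Set $\bar\ell_0:=\ell(T)$, $\bar y_0:=y(T,\cdot)$, $\bar y_1:=\partial_ty(T,\cdot)$ and $\tau_+(t):=t+\ell(t)$. Then $$|(\bar y_1+\bar y_0')(x)|^2\le 2\,\kappa\big(\ell(\tau_+^{-1}(x+T))\big)\quad\text{for } x\in[0,\bar\ell_0],$$ $$|(\bar y_1+\bar y_0')(\tau_+(t)-T)|^2\le 2\,\kappa(\ell(t))\quad\text{for } t\in[\tau_+^{-1}(T),T],$$ where the inequalities hold pointwise for $C^1$-solutions and almost everywhere for $C^{0,1}$-solutions.
   Context: Fix $0<c_1<c_2$ and a locally Lipschitz function $\kappa:[0,\infty)\to[c_1,c_2]$. Debonding system. Given $\ell_0>0$, $(y_0,y_1)$ on $[0,\ell_0]$ and a control $u$ on $[0,T]$, the unknowns are the front $\ell:[0,T]\to(0,\infty)$ and the displacement $y$ on $\{0\le t\le T,\ 0\le x\le \ell(t)\}$. The equations are $\partial_{tt}^2y-\partial_{xx}^2y=0$ for $0<x<\ell(t)$; $y(t,0)=u(t)$; $y(t,\ell(t))=0$; $y(0,\cdot)=y_0$; $\partial_ty(0,\cdot)=y_1$; together with Griffith's criterion $\ell'\ge0$, $G_{\ell'(t)}(t)\le\kappa(\ell(t))$, $\ell'(t)[G_{\ell'(t)}(t)-\kappa(\ell(t))]=0$, $\ell(0)=\ell_0$, where $G_{\ell'(t)}(t)=\frac12(1-\ell'(t)^2)(\partial_xy(t,\ell(t)))^2$.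 Solutions are understood through the following equivalent formulation. Put $\tau_\pm(t)=t\pm\ell(t)$ (strictly increasing). There is $f:[-\ell_0,T]\to\mathbb R$ with (1) $f(s)=\frac12\int_0^{-s}(y_0'-y_1)(\sigma)\,d\sigma$ for $s\in[-\ell_0,0]$; $f(s)=u(s)-u(0)-\frac12\int_0^s(y_0'+y_1)(\sigma)\,d\sigma$ for $s\in(0,\ell_0]$, $s\le T$; $f(s)=u(s)+f(\tau_-(\tau_+^{-1}(s)))$ for $s\in(\ell_0,T]$; (2) $\ell(0)=\ell_0$ and $\ell'(t)=\max\Big[\frac{2f'(t-\ell(t))^2-\kappa(\ell(t))}{2f'(t-\ell(t))^2+\kappa(\ell(t))},0\Big]$; (3) $y(t,x)=f(t-x)-g(t+x)$, where $g(s)=-u(0)-\frac12\int_0^s(y_0'+y_1)(\sigma)\,d\sigma$ for $0\le s\le\ell_0$ and $g(s)=f(\tau_-(\tau_+^{-1}(s)))$ for $\ell_0<s\le T+\ell(T)$ (i.e. $y(t,x)=u(t+x)-f(t+x)+f(t-x)$). A $C^{0,1}$-solution (with $(y_0,y_1)\in C^{0,1}\times L^\infty$, $u\in C^{0,1}([0,T])$) is one with $\ell,y,f$ Lipschitz, in which case (2) and identities between derivatives hold almost everywhere. A $C^1$-solution (with $(y_0,y_1)\in C^1\times C^0$, $u\in C^1([0,T])$) is one with $\ell\in C^1([0,T])$, $y\in C^1(\{0\le t\le T,0\le x\le\ell(t)\})$, $f\in C^1([-\ell_0,T])$, in which case they hold pointwise. Derivatives in $t$ at $t=T$ are one-sided.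 *)

theory Defs
  imports "HOL-Analysis.Analysis"
begin

definition toughness :: "real \<Rightarrow> real \<Rightarrow> (real \<Rightarrow> real) \<Rightarrow> bool" where
  "toughness c1 c2 \<kappa> \<longleftrightarrow>
     (\<forall>r\<ge>0. \<kappa> r \<in> {c1..c2}) \<and> local_lipschitz (UNIV :: real set) {0..} (\<lambda>_. \<kappa>)"

definition Lip_on :: "'a::metric_space set \<Rightarrow> ('a \<Rightarrow> real) \<Rightarrow> bool" where
  "Lip_on S f \<longleftrightarrow> (\<exists>L. L-lipschitz_on S f)"

definition Linf_on :: "real set \<Rightarrow> (real \<Rightarrow> real) \<Rightarrow> bool" where
  "Linf_on S f \<longleftrightarrow> f \<in> borel_measurable (lebesgue_on S) \<and>
     (\<exists>C. AE x in lebesgue_on S. \<bar>f x\<bar> \<le> C)"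

text \<open>Continuous differentiability up to the boundary: the derivative is taken relative to \<open>S\<close>,
  hence one-sided at boundary points, and values of \<open>f\<close> outside \<open>S\<close> are irrelevant.
  (The library's \<open>C1_differentiable_on\<close> uses two-sided derivatives.)\<close>

definition C1_on :: "'a::real_normed_vector set \<Rightarrow> ('a \<Rightarrow> real) \<Rightarrow> bool" where
  "C1_on S f \<longleftrightarrow> (\<exists>D :: 'a \<Rightarrow> 'a \<Rightarrow>\<^sub>L real. continuous_on S D \<and>
     (\<forall>x\<in>S. (f has_derivative blinfun_apply (D x)) (at x within S)))"

abbreviation deriv_on :: "real set \<Rightarrow> (real \<Rightarrow> real) \<Rightarrow> real \<Rightarrow> real" where
  "deriv_on S f x \<equiv> vector_derivative f (at x within S)"

definition tau_plus :: "(real \<Rightarrow> real) \<Rightarrow> real \<Rightarrow> real" where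
  "tau_plus l t = t + l t"

definition tau_minus :: "(real \<Rightarrow> real) \<Rightarrow> real \<Rightarrow> real" where
  "tau_minus l t = t - l t"

definition tau_plus_inv :: "real \<Rightarrow> (real \<Rightarrow> real) \<Rightarrow> real \<Rightarrow> real" where
  "tau_plus_inv T l = inv_into {0..T} (tau_plus l)"

definition debonded_domain :: "real \<Rightarrow> (real \<Rightarrow> real) \<Rightarrow> (real \<times> real) set" where
  "debonded_domain T l = {(t, x). 0 \<le> t \<and> t \<le> T \<and> 0 \<le> x \<and> x \<le> l t}"

definition f_equations ::
  "real \<Rightarrow> real \<Rightarrow> (real \<Rightarrow> real) \<Rightarrow> (real \<Rightarrow> real) \<Rightarrow> (real \<Rightarrow> real) \<Rightarrow>
   (real \<Rightarrow> real) \<Rightarrow> (real \<Rightarrow> real) \<Rightarrow> bool" where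
  "f_equations T l0 y0 y1 u l f \<longleftrightarrow>
     (\<forall>s\<in>{-l0..0}.
        f s = 1/2 * integral {0..-s} (\<lambda>\<sigma>. deriv_on {0..l0} y0 \<sigma> - y1 \<sigma>)) \<and>
     (\<forall>s\<in>{0<..l0}. s \<le> T \<longrightarrow>
        f s = u s - u 0 - 1/2 * integral {0..s} (\<lambda>\<sigma>. deriv_on {0..l0} y0 \<sigma> + y1 \<sigma>)) \<and>
     (\<forall>s\<in>{l0<..T}. f s = u s + f (tau_minus l (tau_plus_inv T l s)))"

definition front_law_at ::
  "real \<Rightarrow> real \<Rightarrow> (real \<Rightarrow> real) \<Rightarrow> (real \<Rightarrow> real) \<Rightarrow> (real \<Rightarrow> real) \<Rightarrow> real \<Rightarrow> bool" where
  "front_law_at T l0 \<kappa> l f t \<longleftrightarrow>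
     (\<exists>p. (f has_real_derivative p) (at (t - l t) within {-l0..T}) \<and>
          (l has_real_derivative
             max ((2 * p\<^sup>2 - \<kappa> (l t)) / (2 * p\<^sup>2 + \<kappa> (l t))) 0) (at t within {0..T}))"

definition g_fun ::
  "real \<Rightarrow> real \<Rightarrow> (real \<Rightarrow> real) \<Rightarrow> (real \<Rightarrow> real) \<Rightarrow> (real \<Rightarrow> real) \<Rightarrow>
   (real \<Rightarrow> real) \<Rightarrow> (real \<Rightarrow> real) \<Rightarrow> real \<Rightarrow> real" where
  "g_fun T l0 y0 y1 u l f s =
     (if s \<le> l0 then - u 0 - 1/2 * integral {0..s} (\<lambda>\<sigma>. deriv_on {0..l0} y0 \<sigma> + y1 \<sigma>)
      else f (tau_minus l (tau_plus_inv T l s)))"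

definition y_representation ::
  "real \<Rightarrow> real \<Rightarrow> (real \<Rightarrow> real) \<Rightarrow> (real \<Rightarrow> real) \<Rightarrow> (real \<Rightarrow> real) \<Rightarrow>
   (real \<Rightarrow> real) \<Rightarrow> (real \<Rightarrow> real \<Rightarrow> real) \<Rightarrow> (real \<Rightarrow> real) \<Rightarrow> bool" where
  "y_representation T l0 y0 y1 u l y f \<longleftrightarrow>
     (\<forall>(t, x)\<in>debonded_domain T l. y t x = f (t - x) - g_fun T l0 y0 y1 u l f (t + x))"

definition admissible_front :: "real \<Rightarrow> real \<Rightarrow> (real \<Rightarrow> real) \<Rightarrow> bool" where
  "admissible_front T l0 l \<longleftrightarrow>
     (\<forall>t\<in>{0..T}. l t > 0) \<and> l 0 = l0 \<and>
     strict_mono_on {0..T} (tau_plus l) \<and> strict_mono_on {0..T} (tau_minus l)"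

text \<open>\<open>y t x\<close> is only meaningful for \<open>(t, x)\<close> in \<open>debonded_domain T l\<close>. In the Lipschitz case the
  data \<open>y1\<close> is a representative of its class; it enters only through integrals.\<close>

definition C01_solution ::
  "(real \<Rightarrow> real) \<Rightarrow> real \<Rightarrow> real \<Rightarrow> (real \<Rightarrow> real) \<Rightarrow> (real \<Rightarrow> real) \<Rightarrow> (real \<Rightarrow> real) \<Rightarrow>
   (real \<Rightarrow> real) \<Rightarrow> (real \<Rightarrow> real \<Rightarrow> real) \<Rightarrow> bool" where
  "C01_solution \<kappa> T l0 y0 y1 u l y \<longleftrightarrow>
     Lip_on {0..l0} y0 \<and> Linf_on {0..l0} y1 \<and> Lip_on {0..T} u \<and>
     admissible_front T l0 l \<and> Lip_on {0..T} l \<and>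
     Lip_on (debonded_domain T l) (\<lambda>(t, x). y t x) \<and>
     (\<exists>f. Lip_on {-l0..T} f \<and> f_equations T l0 y0 y1 u l f \<and>
          (AE t in lebesgue_on {0..T}. front_law_at T l0 \<kappa> l f t) \<and>
          y_representation T l0 y0 y1 u l y f)"

definition C1_solution ::
  "(real \<Rightarrow> real) \<Rightarrow> real \<Rightarrow> real \<Rightarrow> (real \<Rightarrow> real) \<Rightarrow> (real \<Rightarrow> real) \<Rightarrow> (real \<Rightarrow> real) \<Rightarrow>
   (real \<Rightarrow> real) \<Rightarrow> (real \<Rightarrow> real \<Rightarrow> real) \<Rightarrow> bool" where
  "C1_solution \<kappa> T l0 y0 y1 u l y \<longleftrightarrow>
     C1_on {0..l0} y0 \<and> continuous_on {0..l0} y1 \<and> C1_on {0..T} u \<and>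
     admissible_front T l0 l \<and> C1_on {0..T} l \<and>
     C1_on (debonded_domain T l) (\<lambda>(t, x). y t x) \<and>
     (\<exists>f. C1_on {-l0..T} f \<and> f_equations T l0 y0 y1 u l f \<and>
          (\<forall>t\<in>{0..T}. front_law_at T l0 \<kappa> l f t) \<and>
          y_representation T l0 y0 y1 u l y f)"

text \<open>The one-sided derivative in \<open>t\<close> at \<open>t = T\<close>, along the part of the line at height \<open>x\<close> that lies
  in the domain. At the front \<open>x = l T\<close> that part may be the single point \<open>t = T\<close>; there the
  derivative is the continuous extension from \<open>x < l T\<close>, as usual for functions that are
  \<open>C\<^sup>1\<close> on a closed domain.\<close>

definition final_velocity ::
  "real \<Rightarrow> (real \<Rightarrow> real) \<Rightarrow> (real \<Rightarrow> real \<Rightarrow> real) \<Rightarrow> real \<Rightarrow> real" where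
  "final_velocity T l y x =
     (let v = (\<lambda>\<xi>. deriv_on {t\<in>{0..T}. \<xi> \<le> l t} (\<lambda>t. y t \<xi>) T)
      in if x < l T then v x else Lim (at_left (l T)) v)"

end

theory Submission imports Defs begin

text \<open>
  On the domain, \<open>y(t, x) = f(t - x) - g(t + x)\<close>, so the trace \<open>y\<^sub>t + y\<^sub>x\<close> at time \<open>T\<close> is \<open>-2 g'(T + x)\<close>.
  Since \<open>g (\<tau>\<^sub>+ t) = f (\<tau>\<^sub>- t)\<close>, writing \<open>p = f' (\<tau>\<^sub>- t)\<close>, \<open>m = l' t\<close> and \<open>k = \<kappa> (l t)\<close> gives
  \<open>g' (\<tau>\<^sub>+ t) = p (1 - m) / (1 + m)\<close>. The front law makes this \<open>k / (2 p)\<close> if \<open>k \<le> 2 p\<^sup>2\<close> and \<open>p\<close>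
  otherwise; in both cases \<open>(2 g')\<^sup>2 \<le> 2 k\<close>.

  In the Lipschitz case the traces \<open>y\<^sub>t\<close> and \<open>y\<^sub>x\<close> exist separately only where \<open>f\<close> is differentiable at
  \<open>T - x \<ge> \<tau>\<^sub>- T\<close>, beyond the range of \<open>\<tau>\<^sub>-\<close>, where the front law says nothing. This requires the
  almost everywhere differentiability of Lipschitz functions, obtained from the Vitali covering theorem.
\<close>

subsection \<open>Almost everywhere differentiability of Lipschitz functions\<close>

text \<open>Disjointness makes both measures of the union sums over the pieces, so the comparison
  passes termwise. It lifts slope bounds on single intervals to the unions produced by Vitali's
  theorem.\<close>

lemma emeasure_UN_disjoint_le:
  assumes C: "countable C" "disjoint_family_on X C" and s: "sets M = sets N"
    and X: "\<And>i. i \<in> C \<Longrightarrow> X i \<in> sets M"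
    and le: "\<And>i. i \<in> C \<Longrightarrow> emeasure M (X i) \<le> c * emeasure N (X i)"
  shows "emeasure M (\<Union>i\<in>C. X i) \<le> c * emeasure N (\<Union>i\<in>C. X i)"
proof -
  have "emeasure M (\<Union>i\<in>C. X i) = (\<integral>\<^sup>+i. emeasure M (X i) \<partial>count_space C)"
    using C X by (intro emeasure_UN_countable) auto
  also have "\<dots> \<le> (\<integral>\<^sup>+i. c * emeasure N (X i) \<partial>count_space C)"
    using le by (intro nn_integral_mono) auto
  also have "\<dots> = c * (\<integral>\<^sup>+i. emeasure N (X i) \<partial>count_space C)"
    by (intro nn_integral_cmult) auto
  also have "\<dots> = c * emeasure N (\<Union>i\<in>C. X i)"
    using C X s by (subst emeasure_UN_countable) auto
  finally show ?thesis .
qed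

text \<open>\<open>{a..b}\<close> is the closed ball about its midpoint with half its length as
  radius, so the ball form of Vitali's theorem applies; \<open>x\<close> may be any point of the
  interval, even an endpoint. Openness of \<open>U\<close> lets the fine cover be thinned to
  intervals inside \<open>U\<close>.\<close>

lemma Vitali_covering_intervals:
  fixes E U :: "real set"
  assumes "open U" "E \<subseteq> U"
    and fine: "\<And>x d. x \<in> E \<Longrightarrow> 0 < d \<Longrightarrow> \<exists>a b. a \<le> x \<and> x \<le> b \<and> a < b \<and> b - a < d \<and> P a b"
  obtains C where "countable C" "disjoint_family_on (\<lambda>(a, b). {a..b}) C"
    "\<And>a b. (a, b) \<in> C \<Longrightarrow> a < b \<and> P a b \<and> {a..b} \<subseteq> U"
    "negligible (E - (\<Union>(a, b)\<in>C. {a..b}))"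
proof -
  define K where "K = {(a, b). a < b \<and> P a b \<and> {a..b} \<subseteq> U}"
  define m where "m = (\<lambda>(a::real, b::real). (a + b) / 2)"
  define r where "r = (\<lambda>(a::real, b::real). (b - a) / 2)"
  have ball: "cball (m i) (r i) = (case i of (a, b) \<Rightarrow> {a..b})" for i
    by (cases i) (auto simp: m_def r_def cball_def dist_real_def abs_le_iff field_simps)
  have 1: "0 < r i" if "i \<in> K" for i
    using that by (auto simp: K_def r_def)
  have 2: "\<exists>i. i \<in> K \<and> x \<in> cball (m i) (r i) \<and> r i < d" if x: "x \<in> E" and d: "0 < d" for x d
  proof -
    obtain e where e: "e > 0" "ball x e \<subseteq> U"
      using x assms(1,2) by (meson openE subsetD)
    obtain a b where ab: "a \<le> x" "x \<le> b" "a < b" "b - a < min d e" "P a b"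
      using fine[OF x, of "min d e"] d e by auto
    have "{a..b} \<subseteq> ball x e"
      using ab by (auto simp: dist_real_def)
    then have "(a, b) \<in> K" using ab e by (auto simp: K_def)
    moreover have "x \<in> cball (m (a, b)) (r (a, b))" unfolding ball using ab by auto
    moreover have "r (a, b) < d" using ab by (auto simp: r_def)
    ultimately show ?thesis by blast
  qed
  obtain C where C: "countable C" "C \<subseteq> K"
    "pairwise (\<lambda>i j. disjnt (cball (m i) (r i)) (cball (m j) (r j))) C"
    "negligible (E - (\<Union>i\<in>C. cball (m i) (r i)))"
    by (rule Vitali_covering_theorem_cballs[of K r E m, OF 1 2])
  show ?thesis
  proof
    show "disjoint_family_on (\<lambda>(a, b). {a..b}) C"
      using C(3) by (auto simp: ball pairwise_def disjnt_def disjoint_family_on_def)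
    show "negligible (E - (\<Union>(a, b)\<in>C. {a..b}))"
      using C(4) by (simp add: ball)
  qed (use C in \<open>auto simp: K_def\<close>)
qed

lemma negligible_oscillating_slopes:
  fixes F :: "real \<Rightarrow> real" and E :: "real set"
  assumes mono: "mono F" and cont: "continuous_on UNIV F" and bdd: "bounded E"
    and r: "0 < r" "r < s"
    and lo: "\<And>x d. x \<in> E \<Longrightarrow> 0 < d \<Longrightarrow>
        \<exists>a b. a \<le> x \<and> x \<le> b \<and> a < b \<and> b - a < d \<and> F b - F a \<le> r * (b - a)"
    and hi: "\<And>x d. x \<in> E \<Longrightarrow> 0 < d \<Longrightarrow>
        \<exists>a b. a \<le> x \<and> x \<le> b \<and> a < b \<and> b - a < d \<and> F b - F a \<ge> s * (b - a)"
  shows "negligible E"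
proof -
  txt \<open>Covering by intervals of small slope inside \<open>U\<close>, then by intervals of large slope inside these,
    and comparing the measure of \<open>F\<close> with Lebesgue measure gives a neighbourhood of \<open>E\<close> whose measure
    is at most \<open>r / s\<close> times that of \<open>U\<close>, up to an arbitrarily small error. \<open>E\<close> is not known to be
    measurable, so its outer measure \<open>m\<close> is used.\<close>
  let ?\<mu> = "interval_measure F"
  \<comment> \<open>Continuity of \<open>F\<close> excludes atoms, so the closed interval has the
    measure of the half-open one.\<close>
  have \<mu>: "emeasure ?\<mu> {a..b} = ennreal (F b - F a)" if "a \<le> b" for a b
    using that mono cont by (intro emeasure_interval_measure_Icc) (auto simp: mono_def)
  define m where "m = (INF U\<in>{U. open U \<and> E \<subseteq> U}. emeasure lborel U)"
  have m_le: "ennreal (s / r) * m \<le> emeasure lborel U" if U: "open U" "E \<subseteq> U" for U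
  proof -
    obtain C1 where C1: "countable C1" "disjoint_family_on (\<lambda>(a, b). {a..b}) C1"
      "\<And>a b. (a, b) \<in> C1 \<Longrightarrow> a < b \<and> F b - F a \<le> r * (b - a) \<and> {a..b} \<subseteq> U"
      "negligible (E - (\<Union>(a, b)\<in>C1. {a..b}))"
      using Vitali_covering_intervals[OF U lo] by blast
    define W1 where "W1 = (\<Union>(a, b)\<in>C1. {a..b})"
    \<comment> \<open>The second covering has to take place inside an open set. Passing to interiors
      loses only the endpoints, which are countably many.\<close>
    define V where "V = (\<Union>(a, b)\<in>C1. {a<..<b})"
    have "open V" by (auto simp: V_def)
    have "negligible (W1 - V)"
    proof (rule negligible_subset)
      show "negligible (fst ` C1 \<union> snd ` C1)"
        using C1(1) by (auto simp: negligible_iff_null_sets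
            intro!: null_sets_completionI countable_imp_null_set_lborel)
      show "W1 - V \<subseteq> fst ` C1 \<union> snd ` C1"
        by (force simp: W1_def V_def)
    qed
    then have EV: "negligible (E - V)"
      by (rule negligible_subset[OF negligible_Un[OF C1(4)[folded W1_def]]]) auto
    have hi': "\<exists>a b. a \<le> x \<and> x \<le> b \<and> a < b \<and> b - a < d \<and> F b - F a \<ge> s * (b - a)"
      if "x \<in> E \<inter> V" "0 < d" for x d
      using hi[of x d] that by auto
    obtain C2 where C2: "countable C2" "disjoint_family_on (\<lambda>(a, b). {a..b}) C2"
      "\<And>a b. (a, b) \<in> C2 \<Longrightarrow> a < b \<and> F b - F a \<ge> s * (b - a) \<and> {a..b} \<subseteq> V"
      "negligible (E \<inter> V - (\<Union>(a, b)\<in>C2. {a..b}))"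
      using Vitali_covering_intervals[OF \<open>open V\<close> inf_le2 hi'] by blast
    define W2 where "W2 = (\<Union>(a, b)\<in>C2. {a..b})"
    have [measurable]: "W1 \<in> sets borel" "W2 \<in> sets borel"
      unfolding W1_def W2_def using C1(1) C2(1)
      by (auto intro!: sets.countable_UN' simp: split_beta)
    have "W2 \<subseteq> V" using C2(3) by (fastforce simp: W2_def)
    moreover have "V \<subseteq> W1" unfolding V_def W1_def by (intro UN_mono) auto
    moreover have "W1 \<subseteq> U" using C1(3) by (fastforce simp: W1_def)
    ultimately have sub: "W2 \<subseteq> W1" "W1 \<subseteq> U" by auto
    have "emeasure lborel W2 \<le> ennreal (1 / s) * emeasure ?\<mu> W2"
      unfolding W2_def
    proof (rule emeasure_UN_disjoint_le[OF C2(1,2)])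
      fix i assume "i \<in> C2"
      then obtain a b where i: "i = (a, b)" "a < b" "F b - F a \<ge> s * (b - a)"
        using C2(3) by (cases i) auto
      then have "b - a \<le> 1 / s * (F b - F a)" using r by (simp add: field_simps)
      then show "emeasure lborel (case i of (a, b) \<Rightarrow> {a..b})
          \<le> ennreal (1 / s) * emeasure ?\<mu> (case i of (a, b) \<Rightarrow> {a..b})"
        using i r by (simp add: \<mu> ennreal_mult'[symmetric] ennreal_leI)
    qed auto
    also have "\<dots> \<le> ennreal (1 / s) * emeasure ?\<mu> W1"
      using sub by (intro mult_left_mono emeasure_mono) auto
    also have "\<dots> \<le> ennreal (1 / s) * (ennreal r * emeasure lborel W1)"
    proof (rule mult_left_mono)
      show "emeasure ?\<mu> W1 \<le> ennreal r * emeasure lborel W1"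
        unfolding W1_def
      proof (rule emeasure_UN_disjoint_le[OF C1(1,2)])
        fix i assume "i \<in> C1"
        then obtain a b where i: "i = (a, b)" "a < b" "F b - F a \<le> r * (b - a)"
          using C1(3) by (cases i) auto
        then show "emeasure ?\<mu> (case i of (a, b) \<Rightarrow> {a..b})
            \<le> ennreal r * emeasure lborel (case i of (a, b) \<Rightarrow> {a..b})"
          using r by (simp add: \<mu> ennreal_mult'[symmetric] ennreal_leI)
      qed auto
    qed simp
    also have "\<dots> \<le> ennreal (1 / s) * (ennreal r * emeasure lborel U)"
      using sub U by (intro mult_left_mono emeasure_mono) auto
    also have "\<dots> = ennreal (r / s) * emeasure lborel U"
      using r by (simp add: mult.assoc[symmetric] ennreal_mult'[symmetric])
    finally have W2: "emeasure lborel W2 \<le> ennreal (r / s) * emeasure lborel U" .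
    have neg: "negligible (E - W2)"
      by (rule negligible_subset[OF negligible_Un[OF EV C2(4)[folded W2_def]]]) auto
    \<comment> \<open>\<open>Z\<close> contains all of \<open>E\<close>, yet is Lebesgue measurable
      with the measure of \<open>W2\<close>, since the added part is null. Open sets slightly larger
      than \<open>Z\<close> then compete in the infimum \<open>m\<close>.\<close>
    define Z where "Z = W2 \<union> (E - W2)"
    have N: "E - W2 \<in> null_sets lebesgue" using neg by (simp add: negligible_iff_null_sets)
    have W2_leb: "W2 \<in> sets lebesgue" by simp
    have leb: "Z \<in> sets lebesgue" "emeasure lebesgue Z = emeasure lborel W2"
      unfolding Z_def using emeasure_Un_null_set[OF W2_leb N] sets.Un[OF W2_leb null_setsD2[OF N]]
      by (simp_all del: Un_Diff_cancel)
    have "m \<le> emeasure lborel W2"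
    proof (rule ennreal_le_epsilon)
      fix e :: real assume e: "0 < e"
      obtain O' where O': "open O'" "Z \<subseteq> O'" "O' - Z \<in> lmeasurable"
        "emeasure lebesgue (O' - Z) < ennreal e"
        using sets_lebesgue_outer_open[OF leb(1) e] .
      have "m \<le> emeasure lborel O'"
        unfolding m_def using O' by (intro INF_lower) (auto simp: Z_def)
      also have "emeasure lborel O' = emeasure lebesgue (Z \<union> (O' - Z))"
        using O'(1,2) by (simp add: Un_absorb1)
      also have "\<dots> \<le> emeasure lebesgue Z + emeasure lebesgue (O' - Z)"
        using leb O' by (intro emeasure_subadditive) auto
      also have "\<dots> \<le> emeasure lborel W2 + ennreal e"
        unfolding leb using O' by (intro add_left_mono) auto
      finally show "m \<le> emeasure lborel W2 + ennreal e" .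
    qed
    then have "m \<le> ennreal (r / s) * emeasure lborel U" using W2 by (rule order_trans)
    then have "ennreal (s / r) * m \<le> ennreal (s / r) * (ennreal (r / s) * emeasure lborel U)"
      by (rule mult_left_mono) simp
    also have "\<dots> = emeasure lborel U"
      using r by (simp add: mult.assoc[symmetric] ennreal_mult'[symmetric])
    finally show ?thesis .
  qed
  \<comment> \<open>The bound holds for every competitor \<open>U\<close>, hence for the infimum. As
    \<open>s / r > 1\<close> and boundedness of \<open>E\<close> makes \<open>m\<close> finite, only
    \<open>m = 0\<close> remains.\<close>
  then have mm: "ennreal (s / r) * m \<le> m"
    by (subst (2) m_def) (auto intro!: INF_greatest)
  obtain c where c: "E \<subseteq> ball 0 c" using bdd by (meson bounded_subset_ballD)
  have "m \<le> emeasure lborel (ball (0::real) c)"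
    unfolding m_def using c by (intro INF_lower) auto
  also have "\<dots> < top" using emeasure_lborel_ball_finite[of "0::real" c] by simp
  finally obtain x where x: "m = ennreal x" "x \<ge> 0" by (cases m) auto
  have "s / r * x \<le> x"
    using mm x r by (simp add: ennreal_mult'[symmetric])
  then have "(s / r - 1) * x \<le> 0" by (simp add: algebra_simps)
  moreover have "s / r - 1 > 0" using r by simp
  ultimately have "x = 0" using x(2) by (smt (verit) mult_pos_pos)
  then have "m = 0" using x by simp
  show "negligible E" unfolding negligible_outer
  proof safe
    fix e :: real assume e: "0 < e"
    then have "m < ennreal e" using \<open>m = 0\<close> by simp
    then obtain U where U: "open U" "E \<subseteq> U" "emeasure lborel U < ennreal e"
      unfolding m_def INF_less_iff by auto
    have "U \<in> lmeasurable" using U by (auto intro!: fmeasurableI dest: less_trans[OF _ ennreal_less_top])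
    moreover have "measure lebesgue U < e"
      using U e by (simp add: measure_def enn2real_less_iff less_trans[OF _ ennreal_less_top])
    ultimately show "\<exists>T. E \<subseteq> T \<and> T \<in> lmeasurable \<and> measure lebesgue T < e"
      using U by blast
  qed
qed

text \<open>The difference quotient is symmetric in its two endpoints, so increments of either sign
  give an interval ending or starting at \<open>x\<close>. This turns cluster behaviour of quotients
  into the fine covers of the Vitali argument.\<close>

lemma frequently_slope_interval:
  fixes F :: "real \<Rightarrow> real"
  assumes "\<exists>\<^sub>F h in at 0. P ((F (x + h) - F x) / h)" "0 < d"
  shows "\<exists>a b. a \<le> x \<and> x \<le> b \<and> a < b \<and> b - a < d \<and> P ((F b - F a) / (b - a))"
proof -
  have "\<forall>\<^sub>F h in at (0::real). dist h 0 < d \<and> h \<noteq> 0"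
    using assms(2) by (auto simp: eventually_at intro!: exI[of _ d])
  from frequently_eventually_conj[OF assms(1) this]
  obtain h where h: "h \<noteq> 0" "\<bar>h\<bar> < d" "P ((F (x + h) - F x) / h)"
    by (auto dest!: frequently_ex)
  show ?thesis
  proof (cases "h > 0")
    case True
    with h show ?thesis by (intro exI[of _ x] exI[of _ "x + h"]) auto
  next
    case False
    have "(F (x + h) - F x) / h = (F x - F (x + h)) / (x - (x + h))"
      using h by (simp add: field_simps)
    with False h show ?thesis by (intro exI[of _ "x + h"] exI[of _ x]) auto
  qed
qed

theorem Lipschitz_negligible_nondifferentiable:
  fixes f :: "real \<Rightarrow> real"
  assumes lip: "L-lipschitz_on UNIV f"
  shows "negligible {x. \<not> f differentiable (at x)}"
proof -
  txt \<open>The linear term makes all difference quotients of \<open>F\<close> lie in \<open>[1, 2 L + 1]\<close>.\<close>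
  define F where "F = (\<lambda>x. f x + (L + 1) * x)"
  have L: "L \<ge> 0" using lip by (simp add: lipschitz_on_def)
  have fL: "\<bar>f x - f y\<bar> \<le> L * \<bar>x - y\<bar>" for x y
    using lipschitz_onD[OF lip, of x y] by (simp add: dist_real_def)
  have low: "F b - F a \<ge> b - a" and upp: "F b - F a \<le> (2 * L + 1) * (b - a)" if "a \<le> b" for a b
    using fL[of b a] that by (auto simp: F_def algebra_simps)
  have mono: "mono F" using low by (intro monoI) (smt (verit))
  have cont: "continuous_on UNIV F"
    unfolding F_def using lipschitz_on_continuous_on[OF lip] by (intro continuous_intros)
  define q where "q = (\<lambda>x h. (F (x + h) - F x) / h)"
  have q: "1 \<le> q x h" "q x h \<le> 2 * L + 1" if "h \<noteq> 0" for x h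
    using low[of x "x + h"] low[of "x + h" x] upp[of x "x + h"] upp[of "x + h" x] that
    by (cases "h > 0"; auto simp: q_def field_simps)+
  have ev: "\<forall>\<^sub>F h in at (0::real). h \<noteq> 0" by (simp add: eventually_at_filter)
  \<comment> \<open>Where the quotients have no limit, their liminf lies below their limsup and two
    rationals fit in between. Rationals keep the family countable; \<open>n\<close> makes each piece
    bounded.\<close>
  define E where "E = (\<lambda>(r::rat, s::rat, n::nat). {x. \<bar>x\<bar> < real n \<and> 0 < r \<and> r < s \<and>
      (\<exists>\<^sub>F h in at 0. q x h < of_rat r) \<and> (\<exists>\<^sub>F h in at 0. q x h > of_rat s)})"
  have "negligible (E i)" for i
  proof (cases i)
    case (fields r s n)
    show ?thesis
    proof (cases "0 < r \<and> r < s")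
      case True
      show ?thesis
      proof (rule negligible_oscillating_slopes[OF mono cont])
        have "E i \<subseteq> ball 0 (real n)" by (auto simp: E_def fields)
        then show "bounded (E i)" by (rule bounded_subset[OF bounded_ball])
        show "0 < (of_rat r :: real)" "of_rat r < (of_rat s :: real)"
          using True by (auto simp: of_rat_less)
        fix x d :: real assume x: "x \<in> E i" and d: "0 < d"
        then have *: "\<exists>\<^sub>F h in at 0. q x h < of_rat r" "\<exists>\<^sub>F h in at 0. q x h > of_rat s"
          by (auto simp: E_def fields)
        show "\<exists>a b. a \<le> x \<and> x \<le> b \<and> a < b \<and> b - a < d \<and> F b - F a \<le> of_rat r * (b - a)"
          using frequently_slope_interval[of "\<lambda>z. z < of_rat r", OF *(1)[unfolded q_def] d]
          by (auto simp: field_simps) (metis less_eq_real_def)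
        show "\<exists>a b. a \<le> x \<and> x \<le> b \<and> a < b \<and> b - a < d \<and> F b - F a \<ge> of_rat s * (b - a)"
          using frequently_slope_interval[of "\<lambda>z. z > of_rat s", OF *(2)[unfolded q_def] d]
          by (auto simp: field_simps) (metis less_eq_real_def)
      qed
    next
      case False
      then have "E i = {}" by (auto simp: E_def fields)
      then show ?thesis by simp
    qed
  qed
  then have neg: "negligible (\<Union>i. E i)"
    by (intro negligible_countable_Union) auto
  have "{x. \<not> f differentiable (at x)} \<subseteq> (\<Union>i. E i)"
  proof (rule ccontr)
    assume "\<not> ?thesis"
    then obtain x where nd: "\<not> f differentiable (at x)" and xE: "\<And>i. x \<notin> E i" by auto
    let ?q = "\<lambda>h. ereal (q x h)"
    define i where "i = Liminf (at 0) ?q"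
    define S where "S = Limsup (at 0) ?q"
    have nt: "at (0::real) \<noteq> bot" by simp
    have "i \<le> S" unfolding i_def S_def by (rule Liminf_le_Limsup[OF nt])
    have i1: "ereal 1 \<le> i"
      unfolding i_def by (rule Liminf_bounded) (use ev in eventually_elim, use q in auto)
    have S1: "S \<le> ereal (2 * L + 1)"
      unfolding S_def by (rule Limsup_bounded) (use ev in eventually_elim, use q in auto)
    have "\<not> i < S"
    proof
      assume "i < S"
      then obtain r where r: "i < ereal (of_rat r)" "ereal (of_rat r) < S"
        using ereal_dense3 by blast
      then obtain s where s: "ereal (of_rat r) < ereal (of_rat s)" "ereal (of_rat s) < S"
        using ereal_dense3 by blast
      have "ereal 1 < ereal (of_rat r)" using i1 r(1) by (rule le_less_trans)
      then have "(1::real) < of_rat r" by simp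
      then have "0 < (of_rat r :: real)" by linarith
      then have r0: "0 < r" by simp
      have "\<exists>\<^sub>F h in at 0. q x h < of_rat r"
      proof (rule ccontr)
        assume "\<not> ?thesis"
        then have "\<forall>\<^sub>F h in at 0. ereal (of_rat r) \<le> ?q h"
          by (simp add: not_frequently not_less)
        then have "ereal (of_rat r) \<le> i" unfolding i_def by (rule Liminf_bounded)
        with r show False by simp
      qed
      moreover have "\<exists>\<^sub>F h in at 0. q x h > of_rat s"
      proof (rule ccontr)
        assume "\<not> ?thesis"
        then have "\<forall>\<^sub>F h in at 0. ?q h \<le> ereal (of_rat s)"
          by (simp add: not_frequently not_less)
        then have "S \<le> ereal (of_rat s)" unfolding S_def by (rule Limsup_bounded)
        with s show False by simp
      qed
      moreover obtain n where "\<bar>x\<bar> < real n" using reals_Archimedean2 by blast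
      ultimately have "x \<in> E (r, s, n)" using s r0 by (simp add: E_def of_rat_less)
      with xE show False by blast
    qed
    then have "i = S" using \<open>i \<le> S\<close> by simp
    \<comment> \<open>The bounds on the quotients keep the common value of liminf and limsup finite,
      so that it is a derivative.\<close>
    obtain D where D: "S = ereal D" using i1 S1 \<open>i = S\<close> by (cases S) auto
    have "(?q \<longlongrightarrow> S) (at 0)"
      by (rule Liminf_eq_Limsup[OF nt]) (use \<open>i = S\<close> in \<open>auto simp: i_def S_def\<close>)
    then have "(q x \<longlongrightarrow> D) (at 0)" unfolding D by simp
    then have "(F has_real_derivative D) (at x)"
      by (simp add: DERIV_def q_def)
    then have "((\<lambda>z. F z - (L + 1) * z) has_real_derivative D - (L + 1)) (at x)"
      by (auto intro!: derivative_eq_intros)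
    then have "(f has_real_derivative D - (L + 1)) (at x)" by (simp add: F_def)
    then have "f differentiable (at x)" by (auto simp: real_differentiable_def)
    with nd show False by simp
  qed
  then show ?thesis by (rule negligible_subset[OF neg])
qed

text \<open>Clamping to \<open>{a..b}\<close> is 1-Lipschitz, so \<open>g\<close> extends
  \<open>f\<close> to the line with the same constant. The endpoints join the exceptional set; for
  \<open>b \<le> a\<close> the interval has at most one point.\<close>

lemma Lipschitz_on_interval_negligible_nondifferentiable:
  fixes f :: "real \<Rightarrow> real"
  assumes "L-lipschitz_on {a..b} f"
  shows "negligible {x \<in> {a..b}. \<nexists>D. (f has_real_derivative D) (at x within {a..b})}"
proof (cases "a < b")
  case True
  define g where "g = (\<lambda>x. f (max a (min b x)))"
  have L: "L \<ge> 0" using assms by (simp add: lipschitz_on_def)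
  have "L-lipschitz_on UNIV g"
  proof (rule lipschitz_onI[OF _ L])
    fix x y :: real
    have "dist (g x) (g y) \<le> L * dist (max a (min b x)) (max a (min b y))"
      unfolding g_def using True by (intro lipschitz_onD[OF assms]) auto
    also have "\<dots> \<le> L * dist x y"
      by (intro mult_left_mono L) (auto simp: dist_real_def)
    finally show "dist (g x) (g y) \<le> L * dist x y" .
  qed
  then have "negligible ({x. \<not> g differentiable (at x)} \<union> {a, b})"
    using Lipschitz_negligible_nondifferentiable by (intro negligible_Un) auto
  then show ?thesis
  proof (rule negligible_subset, safe)
    fix x assume x: "x \<in> {a..b}" "\<nexists>D. (f has_real_derivative D) (at x within {a..b})"
      "x \<noteq> b" "x \<notin> {}" "g differentiable at x" "x \<noteq> a"
    then obtain D where "(g has_real_derivative D) (at x)" by (auto simp: real_differentiable_def)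
    then have "(g has_real_derivative D) (at x within {a..b})" by (rule has_field_derivative_at_within)
    then have "(f has_real_derivative D) (at x within {a..b})"
      by (rule has_field_derivative_transform_within[OF _ zero_less_one x(1)]) (simp add: g_def)
    with x(2) show False by blast
  qed
next
  case False
  then have "{a..b} \<subseteq> {a}" by auto
  then have "{x \<in> {a..b}. \<nexists>D. (f has_real_derivative D) (at x within {a..b})} \<subseteq> {a}" by blast
  then show ?thesis by (rule negligible_subset[rotated]) simp
qed

subsection \<open>Derivatives and null sets on intervals\<close>

lemma deriv_on_eq:
  assumes "a < b" "x \<in> {a..b}" "(f has_real_derivative D) (at x within {a..b})"
  shows "deriv_on {a..b} f x = D"
  using assms unfolding has_real_derivative_iff_has_vector_derivative
  by (rule vector_derivative_within_closed_interval)

text \<open>A linear map on the reals is multiplication by its value at \<open>1\<close>, so the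
  derivative field \<open>D\<close> becomes the continuous function \<open>D x 1\<close>.
  Nondegeneracy of the interval makes relative derivatives unique, which identifies it with
  \<open>deriv_on\<close>.\<close>

lemma C1_on_interval:
  assumes "a < b" "C1_on {a..b} f"
  shows "\<And>x. x \<in> {a..b} \<Longrightarrow> (f has_real_derivative deriv_on {a..b} f x) (at x within {a..b})"
    and "continuous_on {a..b} (deriv_on {a..b} f)"
proof -
  obtain D :: "real \<Rightarrow> real \<Rightarrow>\<^sub>L real" where D: "continuous_on {a..b} D"
    "\<And>x. x \<in> {a..b} \<Longrightarrow> (f has_derivative blinfun_apply (D x)) (at x within {a..b})"
    using assms(2) by (auto simp: C1_on_def)
  have "(f has_real_derivative D x 1) (at x within {a..b})" if "x \<in> {a..b}" for x
  proof -
    have "blinfun_apply (D x) h = D x 1 * h" for h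
      using blinfun.scaleR_right[of "D x" h 1] by simp
    then have "blinfun_apply (D x) = (*) (D x 1)" by (rule ext)
    then show ?thesis using D(2)[OF that] by (simp add: has_field_derivative_def)
  qed
  note der = this
  have eq: "deriv_on {a..b} f x = D x 1" if "x \<in> {a..b}" for x
    using deriv_on_eq[OF assms(1) that der[OF that]] .
  show "(f has_real_derivative deriv_on {a..b} f x) (at x within {a..b})" if "x \<in> {a..b}" for x
    using der[OF that] eq[OF that] by simp
  have "continuous_on {a..b} (\<lambda>x. blinfun_apply (D x) 1)"
    using D(1) by (intro continuous_intros)
  then show "continuous_on {a..b} (deriv_on {a..b} f)"
    by (rule continuous_on_eq) (simp add: eq)
qed

text \<open>The quotients of \<open>g\<close> are the reciprocals of those of \<open>f\<close>, and
  continuity of \<open>g\<close> carries the limit across. Working relative to \<open>S\<close> and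
  its image includes endpoints of intervals.\<close>

lemma has_field_derivative_inverse_within:
  fixes f :: "real \<Rightarrow> real"
  assumes f: "(f has_field_derivative D) (at t within S)" and "D \<noteq> 0" and t: "t \<in> S"
    and g: "\<And>z. z \<in> S \<Longrightarrow> g (f z) = z" and cont: "continuous_on (f ` S) g"
  shows "(g has_field_derivative inverse D) (at (f t) within f ` S)"
proof -
  have "((\<lambda>z. (f z - f t) / (z - t)) \<longlongrightarrow> D) (at t within S)"
    using f by (simp add: has_field_derivative_iff)
  from tendsto_inverse[OF this \<open>D \<noteq> 0\<close>]
  have *: "((\<lambda>z. (z - t) / (f z - f t)) \<longlongrightarrow> inverse D) (at t within S)" by simp
  have "(g \<longlongrightarrow> t) (at (f t) within f ` S)"
    using cont t g[OF t] by (metis continuous_on_def imageI)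
  moreover have "\<forall>\<^sub>F y in at (f t) within f ` S. g y \<in> S \<and> g y \<noteq> t"
    unfolding eventually_at_filter using g t by (intro always_eventually) auto
  ultimately have "filterlim g (at t within S) (at (f t) within f ` S)"
    by (simp add: filterlim_at)
  from filterlim_compose[OF * this]
  have "((\<lambda>y. (g y - t) / (f (g y) - f t)) \<longlongrightarrow> inverse D) (at (f t) within f ` S)" .
  moreover have "\<forall>\<^sub>F y in at (f t) within f ` S.
      (g y - t) / (f (g y) - f t) = (g y - g (f t)) / (y - f t)"
    unfolding eventually_at_filter using g t by (intro always_eventually) auto
  ultimately show ?thesis
    unfolding has_field_derivative_iff by (rule Lim_transform_eventually)
qed

text \<open>Lebesgue measure is complete, so an exceptional set inside a null set is itself null. In
  the form \<open>negligible\<close>, exceptional sets can be transported by Lipschitz and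
  differentiable maps.\<close>

lemma AE_lebesgue_on_iff_negligible:
  assumes "S \<in> sets lebesgue"
  shows "(AE x in lebesgue_on S. P x) \<longleftrightarrow> negligible {x \<in> S. \<not> P x}"
proof -
  let ?N = "{x \<in> S. \<not> P x}"
  have "(AE x in lebesgue_on S. P x) \<longleftrightarrow> (AE x in lebesgue. x \<notin> ?N)"
    using assms by (subst AE_restrict_space_iff) auto
  also have "\<dots> \<longleftrightarrow> negligible ?N"
  proof
    assume "AE x in lebesgue. x \<notin> ?N"
    then obtain N where "{x \<in> space lebesgue. \<not> x \<notin> ?N} \<subseteq> N" "N \<in> null_sets lebesgue"
      unfolding eventually_ae_filter by blast
    then have "?N \<subseteq> N" "negligible N" by (auto simp: negligible_iff_null_sets)
    then show "negligible ?N" by (metis negligible_subset)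
  qed (simp only: negligible_iff_null_sets AE_not_in)
  finally show ?thesis .
qed

lemma negligible_Lipschitz_image:
  fixes f :: "real \<Rightarrow> real"
  assumes "negligible S" "L-lipschitz_on S f"
  shows "negligible (f ` S)"
proof (rule negligible_locally_Lipschitz_image[OF order_refl assms(1)])
  fix x assume "x \<in> S"
  then show "\<exists>T B. open T \<and> x \<in> T \<and> (\<forall>y \<in> S \<inter> T. norm (f y - f x) \<le> B * norm (y - x))"
    using lipschitz_onD[OF assms(2)] by (intro exI[of _ UNIV] exI[of _ L]) (auto simp: dist_norm)
qed

text \<open>If \<open>k \<le> 2 * p\<^sup>2\<close>, then \<open>(1 - m) / (1 + m)\<close> equals
  \<open>k / (2 * p\<^sup>2)\<close>, the base of the square is \<open>k / p\<close>, and the case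
  assumption bounds one factor \<open>k\<close>. Otherwise the front rests, \<open>m = 0\<close>,
  and the negated assumption is the claim.\<close>

lemma reflected_slope_le:
  fixes p k m :: real
  assumes k: "k > 0" and m: "m = max ((2 * p\<^sup>2 - k) / (2 * p\<^sup>2 + k)) 0"
  shows "(2 * (p * (1 - m) / (1 + m)))\<^sup>2 \<le> 2 * k"
proof (cases "k \<le> 2 * p\<^sup>2")
  case True
  have pos: "2 * p\<^sup>2 + k > 0" using k by (smt (verit) zero_le_power2)
  have p: "p \<noteq> 0" using True k by auto
  have m': "m = (2 * p\<^sup>2 - k) / (2 * p\<^sup>2 + k)"
    unfolding m using True pos by (intro max_absorb1 divide_nonneg_pos) auto
  have "1 - m = (2 * k) / (2 * p\<^sup>2 + k)" "1 + m = 4 * p\<^sup>2 / (2 * p\<^sup>2 + k)"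
    using pos by (auto simp: m' field_simps)
  then have "(1 - m) / (1 + m) = (2 * k) / (4 * p\<^sup>2)"
    using pos by simp
  then have "2 * (p * (1 - m) / (1 + m)) = 2 * (p * ((2 * k) / (4 * p\<^sup>2)))"
    by (metis times_divide_eq_right)
  also have "\<dots> = k / p"
    using p by (simp add: power2_eq_square)
  finally have "2 * (p * (1 - m) / (1 + m)) = k / p" .
  then have "(2 * (p * (1 - m) / (1 + m)))\<^sup>2 = k * k / p\<^sup>2"
    by (simp add: power_divide power2_eq_square)
  also have "\<dots> \<le> k * (2 * p\<^sup>2) / p\<^sup>2"
    using True k by (intro divide_right_mono mult_left_mono) auto
  also have "\<dots> = 2 * k" using p by simp
  finally show ?thesis .
next
  case False
  have "2 * p\<^sup>2 + k > 0" using k by (smt (verit) zero_le_power2)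
  then have "m = 0" unfolding m using False by (intro max_absorb2 divide_nonpos_pos) auto
  then show ?thesis using False by (simp add: power_mult_distrib)
qed

subsection \<open>The reflected wave\<close>

text \<open>This is what both solution classes share. The derivative lemmas take the derivatives of
  \<open>f\<close> and \<open>l\<close> at single points, so they serve the everywhere and the
  almost everywhere setting alike.\<close>

locale debonding_trace =
  fixes T l0 :: real and y0 y1 u l f :: "real \<Rightarrow> real" and y :: "real \<Rightarrow> real \<Rightarrow> real"
  assumes l0: "0 < l0" "l0 < T" and front: "admissible_front T l0 l"
    and cont_l: "continuous_on {0..T} l" and rep: "y_representation T l0 y0 y1 u l y f"
begin

text \<open>\<open>g_fun\<close> above \<open>l0\<close>, extended by the same formula to \<open>l0\<close>, where \<open>g_fun\<close> takes the other branch.\<close>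

definition reflected :: "real \<Rightarrow> real" where
  "reflected s = f (tau_minus l (tau_plus_inv T l s))"

section \<open>Characteristic coordinates of the front\<close>

lemma T_pos: "0 < T" and l_T_pos: "0 < l T" and l_0: "l 0 = l0"
  using l0 front by (auto simp: admissible_front_def)

lemma tau_plus_inv_tau_plus [simp]: "t \<in> {0..T} \<Longrightarrow> tau_plus_inv T l (tau_plus l t) = t"
  unfolding tau_plus_inv_def using front
  by (intro inv_into_f_f strict_mono_on_imp_inj_on) (auto simp: admissible_front_def)

lemma cont_tau_plus: "continuous_on {0..T} (tau_plus l)"
  unfolding tau_plus_def by (intro continuous_intros cont_l)

lemma tau_plus_le_iff: "s \<in> {0..T} \<Longrightarrow> t \<in> {0..T} \<Longrightarrow> tau_plus l s \<le> tau_plus l t \<longleftrightarrow> s \<le> t"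
  using front by (intro strict_mono_on_less_eq) (auto simp: admissible_front_def)

lemma tau_minus_le_iff: "s \<in> {0..T} \<Longrightarrow> t \<in> {0..T} \<Longrightarrow> tau_minus l s \<le> tau_minus l t \<longleftrightarrow> s \<le> t"
  using front by (intro strict_mono_on_less_eq) (auto simp: admissible_front_def)

lemma tau_plus_image: "tau_plus l ` {0..T} = {l0..T + l T}"
proof
  show "tau_plus l ` {0..T} \<subseteq> {l0..T + l T}"
    using tau_plus_le_iff[of 0] tau_plus_le_iff[of _ T] T_pos l_0 by (auto simp: tau_plus_def)
  show "{l0..T + l T} \<subseteq> tau_plus l ` {0..T}"
  proof
    fix s assume "s \<in> {l0..T + l T}"
    then have "tau_plus l 0 \<le> s" "s \<le> tau_plus l T" by (auto simp: tau_plus_def l_0)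
    from IVT'[OF this _ cont_tau_plus] T_pos obtain t where "t \<in> {0..T}" "tau_plus l t = s"
      by auto
    then show "s \<in> tau_plus l ` {0..T}" by blast
  qed
qed

lemma cont_tau_plus_inv: "continuous_on {l0..T + l T} (tau_plus_inv T l)"
  unfolding tau_plus_image[symmetric] by (rule continuous_on_inv[OF cont_tau_plus]) auto

lemma tau_plus_inv_T: "tau_plus_inv T l T \<in> {0..T}"
  using tau_plus_image l0 l_T_pos unfolding tau_plus_inv_def
  by (intro inv_into_into) auto

lemma tau_minus_mem: "t \<in> {0..T} \<Longrightarrow> tau_minus l t \<in> {-l0..T}"
  using tau_minus_le_iff[of 0 t] tau_minus_le_iff[of t T] T_pos l_T_pos l_0
  by (auto simp: tau_minus_def)

lemma tau_plus_inv_has_derivative: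
  assumes t: "t \<in> {0..T}" and m: "(l has_real_derivative m) (at t within {0..T})" "m \<ge> 0"
  shows "(tau_plus_inv T l has_real_derivative inverse (1 + m)) (at (tau_plus l t) within {l0..T + l T})"
  unfolding tau_plus_image[symmetric]
proof (rule has_field_derivative_inverse_within)
  show "(tau_plus l has_real_derivative 1 + m) (at t within {0..T})"
    unfolding tau_plus_def using m by (auto intro!: derivative_eq_intros)
qed (use t m cont_tau_plus_inv in \<open>auto simp: tau_plus_image\<close>)

text \<open>Chain rule for \<open>f\<close> after \<open>tau_minus l\<close> after
  \<open>tau_plus_inv T l\<close>; the last two maps contribute \<open>1 - m\<close> and
  \<open>1 / (1 + m)\<close>, and \<open>m \<ge> 0\<close> keeps \<open>1 + m\<close> away from
  zero.\<close>

lemma reflected_has_derivative: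
  assumes t: "t \<in> {0..T}" and p: "(f has_real_derivative p) (at (tau_minus l t) within {-l0..T})"
    and m: "(l has_real_derivative m) (at t within {0..T})" "m \<ge> 0"
  shows "(reflected has_real_derivative p * (1 - m) / (1 + m)) (at (tau_plus l t) within {l0..T + l T})"
proof -
  have "(tau_minus l has_real_derivative 1 - m) (at t within {0..T})"
    unfolding tau_minus_def using m by (auto intro!: derivative_eq_intros)
  moreover have "(f has_real_derivative p) (at (tau_minus l t) within tau_minus l ` {0..T})"
    using p by (rule DERIV_subset) (use tau_minus_mem in blast)
  ultimately have "(f \<circ> tau_minus l has_real_derivative p * (1 - m)) (at t within {0..T})"
    by (intro DERIV_image_chain)
  moreover have "tau_plus_inv T l ` {l0..T + l T} = {0..T}"
    unfolding tau_plus_image[symmetric] by (force simp: image_image)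
  ultimately have "(f \<circ> tau_minus l has_real_derivative p * (1 - m))
      (at (tau_plus_inv T l (tau_plus l t)) within tau_plus_inv T l ` {l0..T + l T})"
    using t by simp
  from DERIV_image_chain[OF this tau_plus_inv_has_derivative[OF t m]] show ?thesis
    by (simp add: o_def reflected_def[abs_def] divide_inverse)
qed

section \<open>Traces of the displacement at the final time\<close>

lemma y_eq: "\<lbrakk>t \<in> {0..T}; 0 \<le> x; x \<le> l t; l0 < t + x\<rbrakk> \<Longrightarrow> y t x = f (t - x) - reflected (t + x)"
  \<comment> \<open>Strictness of \<open>l0 < t + x\<close> selects the second branch of
    \<open>g_fun\<close>.\<close>
  using rep by (auto simp: y_representation_def debonded_domain_def g_fun_def reflected_def)

text \<open>Since \<open>l0 < T\<close>, every \<open>T + x\<close> lies beyond \<open>l0\<close>,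
  so the formula with \<open>reflected\<close> describes the whole final section, endpoints
  included.\<close>

lemma deriv_on_final_displacement:
  assumes x: "x \<in> {0..l T}" and a: "(f has_real_derivative a) (at (T - x) within {-l0..T})"
    and q: "(reflected has_real_derivative q) (at (T + x) within {l0..T + l T})"
  shows "deriv_on {0..l T} (y T) x = - a - q"
proof (rule deriv_on_eq[OF l_T_pos x])
  have lT: "T - l T \<ge> - l0" using tau_minus_mem[of T] T_pos by (auto simp: tau_minus_def)
  have "(f has_real_derivative a) (at (T - x) within (\<lambda>x. T - x) ` {0..l T})"
    using a by (rule DERIV_subset) (use lT in auto)
  then have A: "(f \<circ> (\<lambda>x. T - x) has_real_derivative a * - 1) (at x within {0..l T})"
    by (rule DERIV_image_chain) (rule derivative_eq_intros | simp)+
  have "(reflected has_real_derivative q) (at (T + x) within (\<lambda>x. T + x) ` {0..l T})"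
    using q by (rule DERIV_subset) (use l0 in auto)
  then have B: "(reflected \<circ> (\<lambda>x. T + x) has_real_derivative q * 1) (at x within {0..l T})"
    by (rule DERIV_image_chain) (rule derivative_eq_intros | simp)+
  from DERIV_diff[OF A B] have "((\<lambda>x. (f \<circ> (\<lambda>x. T - x)) x - (reflected \<circ> (\<lambda>x. T + x)) x) has_real_derivative - a - q)
      (at x within {0..l T})"
    by simp
  then show "(y T has_real_derivative - a - q) (at x within {0..l T})"
    by (rule has_field_derivative_transform_within[OF _ zero_less_one x])
      (use y_eq[of T] T_pos l0 in auto)
qed

lemma deriv_on_time_at_T:
  assumes x: "x \<in> {0..<l T}" and a: "(f has_real_derivative a) (at (T - x) within {-l0..T})"
    and q: "(reflected has_real_derivative q) (at (T + x) within {l0..T + l T})"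
  shows "deriv_on {t\<in>{0..T}. x \<le> l t} (\<lambda>t. y t x) T = a - q"
proof (rule vector_derivative_within)
  let ?S = "{t\<in>{0..T}. x \<le> l t}"
  \<comment> \<open>Restricting to \<open>t \<ge> l0\<close> keeps \<open>t + x\<close> in the
    interval relative to which \<open>reflected\<close> is differentiated. As \<open>l0 < T\<close>,
    the filter at \<open>T\<close> is unchanged.\<close>
  let ?S' = "?S \<inter> {l0..}"
  have TS: "T \<in> ?S" "T \<in> ?S'" using x T_pos l0 by auto
  have "\<forall>\<^sub>F t in at T within {0..T}. x < l t"
    using cont_l x T_pos by (intro order_tendstoD) (auto simp: continuous_on_def)
  then obtain d where d: "d > 0" "\<And>t. t \<in> {0..T} \<Longrightarrow> t \<noteq> T \<Longrightarrow> dist t T < d \<Longrightarrow> x < l t"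
    by (auto simp: eventually_at)
  \<comment> \<open>Halving \<open>d\<close> keeps the closed interval inside the neighbourhood, and
    the bound \<open>T\<close> keeps its times nonnegative. Thus \<open>T\<close> is a limit point
    of \<open>?S\<close>, which makes the derivative there unique.\<close>
  define e where "e = min (d / 2) T"
  have e: "0 < e" "e \<le> T" "e < d" using d T_pos by (auto simp: e_def)
  have "{T - e..T} \<subseteq> ?S"
  proof
    fix t assume t: "t \<in> {T - e..T}"
    show "t \<in> ?S"
      using d(2)[of t] t e TS by (cases "t = T") (auto simp: dist_real_def)
  qed
  moreover have "at T within {T - e..T} \<noteq> bot"
    using e by (simp add: at_within_Icc_at_left)
  ultimately show "at T within ?S \<noteq> bot"
    by (metis at_le bot.extremum_uniqueI)
  \<comment> \<open>\<open>x \<le> l t\<close> places \<open>t - x\<close> above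
    \<open>tau_minus l t\<close> and \<open>t + x\<close> below \<open>tau_plus l t\<close>.\<close>
  have bds: "- l0 \<le> t - x \<and> t - x \<le> T \<and> t + x \<le> T + l T" if "t \<in> ?S" for t
    using that x tau_minus_mem[of t] tau_plus_image by (force simp: tau_minus_def tau_plus_def)
  have "(f has_real_derivative a) (at (T - x) within (\<lambda>t. t - x) ` ?S')"
    using a by (rule DERIV_subset) (use bds in auto)
  then have A: "(f \<circ> (\<lambda>t. t - x) has_real_derivative a * 1) (at T within ?S')"
    by (rule DERIV_image_chain) (rule derivative_eq_intros | simp)+
  have "(reflected has_real_derivative q) (at (T + x) within (\<lambda>t. t + x) ` ?S')"
    using q by (rule DERIV_subset) (use bds x in auto)
  then have B: "(reflected \<circ> (\<lambda>t. t + x) has_real_derivative q * 1) (at T within ?S')"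
    by (rule DERIV_image_chain) (rule derivative_eq_intros | simp)+
  from DERIV_diff[OF A B] have "((\<lambda>t. (f \<circ> (\<lambda>t. t - x)) t - (reflected \<circ> (\<lambda>t. t + x)) t) has_real_derivative a - q)
      (at T within ?S')"
    by simp
  moreover have "at T within ?S' = at T within ?S"
    by (rule at_within_nhd[of _ "{l0<..}"]) (use l0 in auto)
  ultimately have "((\<lambda>t. (f \<circ> (\<lambda>t. t - x)) t - (reflected \<circ> (\<lambda>t. t + x)) t) has_real_derivative a - q)
      (at T within ?S)"
    by simp
  then have "((\<lambda>t. y t x) has_real_derivative a - q) (at T within ?S)"
  proof (rule has_field_derivative_transform_within[OF _ _ TS(1)])
    show "0 < T - l0" using l0 by simp
    fix t assume "t \<in> ?S" "dist t T < T - l0"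
    then show "(f \<circ> (\<lambda>t. t - x)) t - (reflected \<circ> (\<lambda>t. t + x)) t = y t x"
      using x by (subst y_eq) (auto simp: dist_real_def)
  qed
  then show "((\<lambda>t. y t x) has_vector_derivative a - q) (at T within ?S)"
    by (simp add: has_real_derivative_iff_has_vector_derivative)
qed

lemma front_law_bound:
  assumes t: "t \<in> {0..T}" and law: "front_law_at T l0 \<kappa> l f t" and \<kappa>: "\<kappa> (l t) > 0"
  obtains q where "(reflected has_real_derivative q) (at (tau_plus l t) within {l0..T + l T})"
    "(2 * q)\<^sup>2 \<le> 2 * \<kappa> (l t)"
proof -
  obtain p where p: "(f has_real_derivative p) (at (t - l t) within {-l0..T})"
    "(l has_real_derivative max ((2 * p\<^sup>2 - \<kappa> (l t)) / (2 * p\<^sup>2 + \<kappa> (l t))) 0) (at t within {0..T})"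
    using law by (auto simp: front_law_at_def)
  show ?thesis
    using that[OF reflected_has_derivative[OF t p(1)[folded tau_minus_def] p(2)]]
      reflected_slope_le[OF \<kappa> refl] by simp
qed

text \<open>Differentiability of \<open>f\<close> at \<open>T - x\<close> makes each trace a genuine
  derivative. Its value \<open>a\<close> cancels in the sum, leaving \<open>- 2 * q\<close>, and
  \<open>q\<close> is controlled by the front law at the time \<open>t\<close> of
  reflection.\<close>

lemma trace_bound:
  assumes t: "t \<in> {0..T}" "tau_plus l t = T + x" and x: "x \<in> {0..<l T}"
    and law: "front_law_at T l0 \<kappa> l f t" and \<kappa>: "\<kappa> (l t) > 0"
    and a: "(f has_real_derivative a) (at (T - x) within {-l0..T})"
  shows "\<bar>final_velocity T l y x + deriv_on {0..l T} (y T) x\<bar>\<^sup>2 \<le> 2 * \<kappa> (l t)"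
proof -
  obtain q where q: "(reflected has_real_derivative q) (at (T + x) within {l0..T + l T})"
    "(2 * q)\<^sup>2 \<le> 2 * \<kappa> (l t)"
    using front_law_bound[OF t(1) law \<kappa>] t(2) by metis
  have "final_velocity T l y x = a - q"
    using deriv_on_time_at_T[OF x a q(1)] x by (simp add: final_velocity_def)
  moreover have "deriv_on {0..l T} (y T) x = - a - q"
    using x by (intro deriv_on_final_displacement[OF _ a q(1)]) auto
  ultimately show ?thesis using q(2) by (simp add: power2_eq_square)
qed

text \<open>The characteristic leaving the front at time \<open>t\<close> meets time
  \<open>T\<close> at \<open>x = tau_plus l t - T\<close>. This links the two parametrizations of
  the final section, by \<open>t\<close> and by \<open>x\<close>.\<close>

lemma tau_plus_mem_iff: "t \<in> {0..T} \<Longrightarrow> tau_plus l t \<in> {T..T + l T} \<longleftrightarrow> tau_plus_inv T l T \<le> t"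
proof -
  assume t: "t \<in> {0..T}"
  have "T \<in> tau_plus l ` {0..T}" using tau_plus_image l0 l_T_pos by auto
  then have "tau_plus l (tau_plus_inv T l T) = T"
    unfolding tau_plus_inv_def by (rule f_inv_into_f)
  moreover have "tau_plus l t \<le> T + l T" using t tau_plus_image by auto
  ultimately show ?thesis using tau_plus_le_iff[OF tau_plus_inv_T t] by auto
qed

lemma final_time_preimage:
  assumes "x \<in> {0..l T}"
  obtains t where "t \<in> {0..T}" "tau_plus l t = T + x" "tau_plus_inv T l (x + T) = t"
proof -
  have "T + x \<in> tau_plus l ` {0..T}" using assms tau_plus_image l0 by auto
  then obtain t where "t \<in> {0..T}" "tau_plus l t = T + x" by force
  then show ?thesis using that tau_plus_inv_tau_plus[of t] by (simp add: add.commute)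
qed

section \<open>Almost everywhere bounds for Lipschitz solutions\<close>

lemma Lipschitz_trace_bounds:
  assumes f: "Lip_on {-l0..T} f" and l: "Lip_on {0..T} l"
    and law: "AE t in lebesgue_on {0..T}. front_law_at T l0 \<kappa> l f t"
    and \<kappa>: "\<And>t. t \<in> {0..T} \<Longrightarrow> \<kappa> (l t) > 0"
  shows "AE x in lebesgue_on {0..l T}.
      \<bar>final_velocity T l y x + deriv_on {0..l T} (y T) x\<bar>\<^sup>2 \<le> 2 * \<kappa> (l (tau_plus_inv T l (x + T)))"
    and "AE t in lebesgue_on {tau_plus_inv T l T..T}.
      \<bar>final_velocity T l y (tau_plus l t - T) + deriv_on {0..l T} (y T) (tau_plus l t - T)\<bar>\<^sup>2
        \<le> 2 * \<kappa> (l t)"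
proof -
  txt \<open>\<open>Nl\<close>, \<open>Nf\<close> are carried to null sets of \<open>x\<close> by \<open>tau_plus l\<close> and a reflection. In the variable \<open>t\<close>,
    \<open>Nf\<close> is pulled back by \<open>tau_plus l\<close>, so one needs the inverse of \<open>tau_plus l\<close> to preserve null
    sets; it does off the image of \<open>Nl\<close>, being differentiable there.\<close>
  define Nl where "Nl = {t \<in> {0..T}. \<not> front_law_at T l0 \<kappa> l f t}"
  define Nf where "Nf = {s \<in> {-l0..T}. \<nexists>a. (f has_real_derivative a) (at s within {-l0..T})}"
  have Nl: "negligible Nl"
    using law unfolding Nl_def by (subst (asm) AE_lebesgue_on_iff_negligible) auto
  have Nf: "negligible Nf"
    using f Lipschitz_on_interval_negligible_nondifferentiable unfolding Nf_def Lip_on_def by blast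
  \<comment> \<open>Stated in the front time \<open>t\<close>, this serves both inequalities, with
    \<open>x = tau_plus l t - T\<close>.\<close>
  define bad where "bad t \<longleftrightarrow> \<not> \<bar>final_velocity T l y (tau_plus l t - T)
      + deriv_on {0..l T} (y T) (tau_plus l t - T)\<bar>\<^sup>2 \<le> 2 * \<kappa> (l t)" for t
  \<comment> \<open>At \<open>t = T\<close> the point is \<open>x = l T\<close>, where
    \<open>final_velocity\<close> is a limit. The number \<open>2 * T - tau_plus l t\<close> is
    \<open>T - x\<close>, the argument at which \<open>f\<close> should be differentiable.\<close>
  have bad: "t = T \<or> t \<in> Nl \<or> 2 * T - tau_plus l t \<in> Nf"
    if t: "t \<in> {0..T}" "tau_plus_inv T l T \<le> t" "bad t" for t
  proof (rule ccontr)
    assume neg: "\<not> (t = T \<or> t \<in> Nl \<or> 2 * T - tau_plus l t \<in> Nf)"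
    define x where "x = tau_plus l t - T"
    have "tau_plus l t \<noteq> tau_plus l T"
      using tau_plus_le_iff[of T t] t neg T_pos by auto
    then have x: "x \<in> {0..<l T}"
      using t tau_plus_mem_iff[of t] by (auto simp: x_def tau_plus_def)
    have "T - x \<in> {-l0..T}" using x tau_minus_mem[of T] T_pos by (auto simp: tau_minus_def)
    moreover have "T - x = 2 * T - tau_plus l t" by (simp add: x_def)
    ultimately obtain a where a: "(f has_real_derivative a) (at (T - x) within {-l0..T})"
      using neg by (auto simp: Nf_def)
    have "front_law_at T l0 \<kappa> l f t" using neg t by (auto simp: Nl_def)
    from trace_bound[OF t(1) _ x this \<kappa>[OF t(1)] a] t(3) show False
      by (simp add: bad_def x_def)
  qed
  obtain L where L: "L-lipschitz_on {0..T} l" using l by (auto simp: Lip_on_def)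
  have tau_lip: "(1 + L)-lipschitz_on {0..T} (\<lambda>t. tau_plus l t - T)"
  proof (rule lipschitz_onI)
    show "0 \<le> 1 + L" using L by (simp add: lipschitz_on_def)
    fix s t assume "s \<in> {0..T}" "t \<in> {0..T}"
    from lipschitz_onD[OF L this]
    show "dist (tau_plus l s - T) (tau_plus l t - T) \<le> (1 + L) * dist s t"
      by (auto simp: tau_plus_def dist_real_def distrib_right)
  qed
  have "negligible ((\<lambda>t. tau_plus l t - T) ` Nl)"
    by (rule negligible_Lipschitz_image[OF Nl lipschitz_on_subset[OF tau_lip]]) (auto simp: Nl_def)
  moreover have "negligible ((\<lambda>s. T - s) ` Nf)"
    by (rule negligible_Lipschitz_image[OF Nf, of 1]) (auto simp: lipschitz_on_def dist_real_def)
  ultimately have neg1: "negligible ({l T} \<union> (\<lambda>t. tau_plus l t - T) ` Nl \<union> (\<lambda>s. T - s) ` Nf)"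
    by (intro negligible_Un) auto
  show "AE x in lebesgue_on {0..l T}.
      \<bar>final_velocity T l y x + deriv_on {0..l T} (y T) x\<bar>\<^sup>2 \<le> 2 * \<kappa> (l (tau_plus_inv T l (x + T)))"
  proof (subst AE_lebesgue_on_iff_negligible)
    show "negligible {x \<in> {0..l T}. \<not> \<bar>final_velocity T l y x + deriv_on {0..l T} (y T) x\<bar>\<^sup>2
        \<le> 2 * \<kappa> (l (tau_plus_inv T l (x + T)))}"
    proof (rule negligible_subset[OF neg1], rule subsetI)
      fix x assume "x \<in> {x \<in> {0..l T}. \<not> \<bar>final_velocity T l y x + deriv_on {0..l T} (y T) x\<bar>\<^sup>2
        \<le> 2 * \<kappa> (l (tau_plus_inv T l (x + T)))}"
      then have x: "x \<in> {0..l T}" and nx: "\<not> \<bar>final_velocity T l y x + deriv_on {0..l T} (y T) x\<bar>\<^sup>2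
        \<le> 2 * \<kappa> (l (tau_plus_inv T l (x + T)))" by auto
      obtain t where t: "t \<in> {0..T}" "tau_plus l t = T + x" "tau_plus_inv T l (x + T) = t"
        using final_time_preimage[OF x] .
      have x_eq: "x = tau_plus l t - T" and xf: "x = T - (2 * T - tau_plus l t)" using t by auto
      have "bad t" using nx t by (simp add: bad_def)
      moreover have "tau_plus_inv T l T \<le> t" using tau_plus_mem_iff[OF t(1)] t(2) x by auto
      ultimately consider "t = T" | "t \<in> Nl" | "2 * T - tau_plus l t \<in> Nf" using bad t(1) by blast
      then show "x \<in> {l T} \<union> (\<lambda>t. tau_plus l t - T) ` Nl \<union> (\<lambda>s. T - s) ` Nf"
      proof cases
        case 1 then show ?thesis using t(2) by (simp add: tau_plus_def)
      next
        case 2 then show ?thesis using x_eq by blast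
      next
        case 3 then show ?thesis using xf by blast
      qed
    qed
  qed simp
  define B where "B = (\<lambda>s. 2 * T - s) ` Nf \<inter> tau_plus l ` ({0..T} - Nl)"
  have "negligible ((\<lambda>s. 2 * T - s) ` Nf)"
    by (rule negligible_Lipschitz_image[OF Nf, of 1]) (auto simp: lipschitz_on_def dist_real_def)
  then have "negligible B" unfolding B_def by (rule negligible_subset) auto
  moreover have "tau_plus_inv T l differentiable_on B"
  proof (unfold differentiable_on_def, rule ballI)
    fix s assume "s \<in> B"
    then obtain t where t: "s = tau_plus l t" "t \<in> {0..T}" "front_law_at T l0 \<kappa> l f t"
      unfolding B_def Nl_def by blast
    then obtain m where "(l has_real_derivative m) (at t within {0..T})" "m \<ge> 0"
      unfolding front_law_at_def by (metis max.cobounded2)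
    from tau_plus_inv_has_derivative[OF t(2) this]
    have "(tau_plus_inv T l has_real_derivative inverse (1 + m)) (at s within B)"
      unfolding t(1) by (rule DERIV_subset) (use tau_plus_image in \<open>auto simp: B_def\<close>)
    then show "tau_plus_inv T l differentiable (at s within B)"
      unfolding real_differentiable_def by blast
  qed
  ultimately have "negligible (tau_plus_inv T l ` B)"
    using negligible_differentiable_image_negligible by blast
  then have neg2: "negligible ({T} \<union> Nl \<union> tau_plus_inv T l ` B)"
    using Nl by (intro negligible_Un) auto
  show "AE t in lebesgue_on {tau_plus_inv T l T..T}.
      \<bar>final_velocity T l y (tau_plus l t - T) + deriv_on {0..l T} (y T) (tau_plus l t - T)\<bar>\<^sup>2
        \<le> 2 * \<kappa> (l t)"
  proof (subst AE_lebesgue_on_iff_negligible)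
    show "negligible {t \<in> {tau_plus_inv T l T..T}. \<not> \<bar>final_velocity T l y (tau_plus l t - T)
      + deriv_on {0..l T} (y T) (tau_plus l t - T)\<bar>\<^sup>2 \<le> 2 * \<kappa> (l t)}"
      unfolding bad_def[symmetric]
    proof (rule negligible_subset[OF neg2], rule subsetI)
      fix t assume "t \<in> {t \<in> {tau_plus_inv T l T..T}. bad t}"
      then have t: "t \<in> {0..T}" "tau_plus_inv T l T \<le> t" "bad t" using tau_plus_inv_T by auto
      \<comment> \<open>Splitting off \<open>t \<notin> Nl\<close> puts \<open>tau_plus l t\<close>
        into \<open>B\<close> in the last case.\<close>
      consider "t = T" | "t \<in> Nl" | "t \<notin> Nl" "2 * T - tau_plus l t \<in> Nf" using bad[OF t] by blast
      then show "t \<in> {T} \<union> Nl \<union> tau_plus_inv T l ` B"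
      proof cases
        case 3
        have "tau_plus l t = 2 * T - (2 * T - tau_plus l t)" by simp
        then have "tau_plus l t \<in> B" unfolding B_def using 3 t(1) by blast
        then have "tau_plus_inv T l (tau_plus l t) \<in> tau_plus_inv T l ` B" by blast
        then show ?thesis using t(1) by simp
      qed auto
    qed
  qed simp
qed

section \<open>Pointwise bounds for continuously differentiable solutions\<close>

lemma C1_trace_bounds:
  assumes f: "C1_on {-l0..T} f" and l: "C1_on {0..T} l"
    and law: "\<And>t. t \<in> {0..T} \<Longrightarrow> front_law_at T l0 \<kappa> l f t"
    and \<kappa>: "\<And>t. t \<in> {0..T} \<Longrightarrow> \<kappa> (l t) > 0"
    and t: "t \<in> {0..T}" "tau_plus l t = T + x" and x: "x \<in> {0..l T}"
  shows "\<bar>final_velocity T l y x + deriv_on {0..l T} (y T) x\<bar>\<^sup>2 \<le> 2 * \<kappa> (l t)"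
proof (cases "x < l T")
  case True
  have "T - x \<in> {-l0..T}" using x tau_minus_mem[of T] T_pos by (auto simp: tau_minus_def)
  from C1_on_interval(1)[OF _ f this] show ?thesis
    using True x t l0 law \<kappa> by (intro trace_bound) auto
next
  case False
  \<comment> \<open>At the front \<open>final_velocity\<close> is a limit from the left, so the
    velocity at nearby points is brought into a form continuous up to \<open>l T\<close>.\<close>
  then have x_eq: "x = l T" using x by auto
  have "tau_plus l t = tau_plus l T" using t(2) x_eq by (simp add: tau_plus_def)
  then have t_eq: "t = T" using tau_plus_inv_tau_plus t(1) T_pos
    by (metis atLeastAtMost_iff less_eq_real_def order_refl)
  let ?f' = "deriv_on {-l0..T} f" and ?l' = "deriv_on {0..T} l"
  have lT: "-l0 < T" using l0 by simp
  note f' = C1_on_interval[OF lT f] and l' = C1_on_interval[OF T_pos l]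
  have l'_nonneg: "?l' s \<ge> 0" if s: "s \<in> {0..T}" for s
  proof -
    obtain m where "(l has_real_derivative m) (at s within {0..T})" "m \<ge> 0"
      using law[OF s] unfolding front_law_at_def by (metis max.cobounded2)
    then show ?thesis using deriv_on_eq[OF T_pos s] by simp
  qed
  \<comment> \<open>\<open>Q s\<close> is the slope of the reflected wave leaving the front at time
    \<open>s\<close>; \<open>?l' \<ge> 0\<close> keeps the denominator positive, which gives
    continuity.\<close>
  define Q where "Q = (\<lambda>s. ?f' (tau_minus l s) * (1 - ?l' s) / (1 + ?l' s))"
  have refl': "(reflected has_real_derivative Q s) (at (tau_plus l s) within {l0..T + l T})"
    if s: "s \<in> {0..T}" for s
    unfolding Q_def
    by (intro reflected_has_derivative s f' l' l'_nonneg tau_minus_mem)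
  \<comment> \<open>For \<open>\<xi> < l T\<close> this is the time derivative at \<open>T\<close>;
    the formula also makes sense at \<open>\<xi> = l T\<close> and is continuous there.\<close>
  define V where "V = (\<lambda>\<xi>. ?f' (T - \<xi>) - Q (tau_plus_inv T l (T + \<xi>)))"
  have mem: "T - \<xi> \<in> {-l0..T}" if "\<xi> \<in> {0..l T}" for \<xi>
    using that tau_minus_mem[of T] T_pos by (auto simp: tau_minus_def)
  have "continuous_on {0..T} Q"
  proof -
    have "continuous_on {0..T} (tau_minus l)"
      unfolding tau_minus_def by (intro continuous_intros cont_l)
    then have "continuous_on {0..T} (\<lambda>s. ?f' (tau_minus l s))"
      by (rule continuous_on_compose2[OF f'(2)]) (use tau_minus_mem in auto)
    then show ?thesis
      unfolding Q_def using l'(2) l'_nonneg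
      by (intro continuous_intros) (force simp: add_nonneg_eq_0_iff)+
  qed
  then have "continuous_on {l0..T + l T} (\<lambda>s. Q (tau_plus_inv T l s))"
    by (rule continuous_on_compose2[OF _ cont_tau_plus_inv])
      (auto simp: tau_plus_image[symmetric])
  then have "continuous_on {0..l T} (\<lambda>\<xi>. Q (tau_plus_inv T l (T + \<xi>)))"
    by (rule continuous_on_compose2) (use l0 in \<open>auto intro!: continuous_intros\<close>)
  moreover have "continuous_on {0..l T} (\<lambda>\<xi>. ?f' (T - \<xi>))"
    by (rule continuous_on_compose2[OF f'(2)]) (use mem in \<open>auto intro!: continuous_intros\<close>)
  ultimately have "continuous_on {0..l T} V"
    unfolding V_def by (intro continuous_intros)
  then have V_lim: "(V \<longlongrightarrow> V (l T)) (at_left (l T))"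
    using l_T_pos by (simp add: continuous_on_Icc_at_leftD)
  let ?v = "\<lambda>\<xi>. deriv_on {t\<in>{0..T}. \<xi> \<le> l t} (\<lambda>t. y t \<xi>) T"
  have "?v \<xi> = V \<xi>" if \<xi>: "\<xi> \<in> {0..<l T}" for \<xi>
  proof -
    obtain s where s: "s \<in> {0..T}" "tau_plus l s = T + \<xi>" "tau_plus_inv T l (\<xi> + T) = s"
      using final_time_preimage[of \<xi>] \<xi> by auto
    have "V \<xi> = ?f' (T - \<xi>) - Q s" using s by (simp add: V_def add.commute)
    moreover have "?v \<xi> = ?f' (T - \<xi>) - Q s"
      using refl'[OF s(1)] s(2) \<xi> mem[of \<xi>] by (intro deriv_on_time_at_T[OF \<xi>] f') auto
    ultimately show ?thesis by simp
  qed
  moreover have "\<forall>\<^sub>F \<xi> in at_left (l T). \<xi> \<in> {0<..<l T}"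
    using l_T_pos by (rule eventually_at_left_real)
  ultimately have "\<forall>\<^sub>F \<xi> in at_left (l T). V \<xi> = ?v \<xi>"
    by (auto elim!: eventually_mono)
  from Lim_transform_eventually[OF V_lim this]
  have "Lim (at_left (l T)) ?v = V (l T)"
    by (intro tendsto_Lim) auto
  then have vel: "final_velocity T l y x = ?f' (T - x) - Q T"
    using x_eq T_pos tau_plus_inv_tau_plus[of T] by (simp add: final_velocity_def V_def tau_plus_def)
  have TT: "T \<in> {0..T}" using T_pos by auto
  have refl_T: "(reflected has_real_derivative Q T) (at (T + x) within {l0..T + l T})"
    using refl'[OF TT] x_eq by (simp add: tau_plus_def)
  have disp: "deriv_on {0..l T} (y T) x = - ?f' (T - x) - Q T"
    by (intro deriv_on_final_displacement x refl_T f' mem)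
  obtain q where q: "(reflected has_real_derivative q) (at (T + x) within {l0..T + l T})"
    "(2 * q)\<^sup>2 \<le> 2 * \<kappa> (l t)"
    using front_law_bound[OF t(1) law \<kappa>] t by metis
  \<comment> \<open>Derivatives within a nondegenerate interval are unique, so the bound on
    \<open>q\<close> applies to \<open>Q T\<close>.\<close>
  have "Q T = q"
    using deriv_on_eq[OF _ _ refl_T] deriv_on_eq[OF _ _ q(1)] x l0 l_T_pos by auto
  then show ?thesis using q(2) by (simp add: vel disp)
qed

end

section \<open>Bounds on the final state for both solution classes\<close>

theorem proposition3p2:
  fixes c1 c2 T l0 lbar0 :: real
    and \<kappa> y0 y1 u l ybar0 ybar1 :: "real \<Rightarrow> real"
    and y :: "real \<Rightarrow> real \<Rightarrow> real"
  assumes "0 < c1" and "c1 < c2" and "toughness c1 c2 \<kappa>"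
    and "0 < l0" and "l0 < T"
  defines "lbar0 \<equiv> l T"
    and "ybar0 \<equiv> y T"
    and "ybar1 \<equiv> final_velocity T l y"
  shows "(C01_solution \<kappa> T l0 y0 y1 u l y \<longrightarrow>
            (AE x in lebesgue_on {0..lbar0}.
               \<bar>ybar1 x + deriv_on {0..lbar0} ybar0 x\<bar>\<^sup>2
                 \<le> 2 * \<kappa> (l (tau_plus_inv T l (x + T)))) \<and>
            (AE t in lebesgue_on {tau_plus_inv T l T..T}.
               \<bar>ybar1 (tau_plus l t - T) + deriv_on {0..lbar0} ybar0 (tau_plus l t - T)\<bar>\<^sup>2
                 \<le> 2 * \<kappa> (l t)))
       \<and> (C1_solution \<kappa> T l0 y0 y1 u l y \<longrightarrow>
            (\<forall>x\<in>{0..lbar0}.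
               \<bar>ybar1 x + deriv_on {0..lbar0} ybar0 x\<bar>\<^sup>2
                 \<le> 2 * \<kappa> (l (tau_plus_inv T l (x + T)))) \<and>
            (\<forall>t\<in>{tau_plus_inv T l T..T}.
               \<bar>ybar1 (tau_plus l t - T) + deriv_on {0..lbar0} ybar0 (tau_plus l t - T)\<bar>\<^sup>2
                 \<le> 2 * \<kappa> (l t)))"
  unfolding lbar0_def ybar0_def ybar1_def
proof (intro conjI impI)
  have \<kappa>: "\<kappa> (l t) > 0" if "admissible_front T l0 l" "t \<in> {0..T}" for t
  proof -
    have "l t \<ge> 0" using that by (auto simp: admissible_front_def intro: less_imp_le)
    then show ?thesis using assms(1,3) by (force simp: toughness_def)
  qed
  {
    assume "C01_solution \<kappa> T l0 y0 y1 u l y"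
    then obtain f where sol: "admissible_front T l0 l" "Lip_on {0..T} l" "Lip_on {-l0..T} f"
      "AE t in lebesgue_on {0..T}. front_law_at T l0 \<kappa> l f t" "y_representation T l0 y0 y1 u l y f"
      unfolding C01_solution_def by auto
    interpret debonding_trace T l0 y0 y1 u l f y
      using sol assms(4,5) by unfold_locales (auto simp: Lip_on_def intro: lipschitz_on_continuous_on)
    note bounds = Lipschitz_trace_bounds[OF sol(3,2,4) \<kappa>[OF sol(1)]]
    show "AE x in lebesgue_on {0..l T}. \<bar>final_velocity T l y x + deriv_on {0..l T} (y T) x\<bar>\<^sup>2
        \<le> 2 * \<kappa> (l (tau_plus_inv T l (x + T)))"
      by (rule bounds(1))
    show "AE t in lebesgue_on {tau_plus_inv T l T..T}.
        \<bar>final_velocity T l y (tau_plus l t - T) + deriv_on {0..l T} (y T) (tau_plus l t - T)\<bar>\<^sup>2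
          \<le> 2 * \<kappa> (l t)"
      by (rule bounds(2))
  }
  {
    assume "C1_solution \<kappa> T l0 y0 y1 u l y"
    then obtain f where sol: "admissible_front T l0 l" "C1_on {0..T} l" "C1_on {-l0..T} f"
      "\<And>t. t \<in> {0..T} \<Longrightarrow> front_law_at T l0 \<kappa> l f t" "y_representation T l0 y0 y1 u l y f"
      unfolding C1_solution_def by auto
    have "continuous_on {0..T} l"
      using sol(2) unfolding C1_on_def by (meson has_derivative_continuous_on)
    then interpret debonding_trace T l0 y0 y1 u l f y
      using sol assms(4,5) by unfold_locales auto
    note bound = C1_trace_bounds[OF sol(3,2,4) \<kappa>[OF sol(1)]]
    show "\<forall>x\<in>{0..l T}. \<bar>final_velocity T l y x + deriv_on {0..l T} (y T) x\<bar>\<^sup>2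
        \<le> 2 * \<kappa> (l (tau_plus_inv T l (x + T)))"
    proof
      fix x assume x: "x \<in> {0..l T}"
      \<comment> \<open>\<open>t\<close> is the time at which the characteristic through
        \<open>(T, x)\<close> leaves the front.\<close>
      obtain t where "t \<in> {0..T}" "tau_plus l t = T + x" "tau_plus_inv T l (x + T) = t"
        using final_time_preimage[OF x] .
      then show "\<bar>final_velocity T l y x + deriv_on {0..l T} (y T) x\<bar>\<^sup>2
          \<le> 2 * \<kappa> (l (tau_plus_inv T l (x + T)))"
        using bound[of t x] x by simp
    qed
    show "\<forall>t\<in>{tau_plus_inv T l T..T}.
        \<bar>final_velocity T l y (tau_plus l t - T) + deriv_on {0..l T} (y T) (tau_plus l t - T)\<bar>\<^sup>2
          \<le> 2 * \<kappa> (l t)"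
    proof
      fix t assume t: "t \<in> {tau_plus_inv T l T..T}"
      then have "t \<in> {0..T}" using tau_plus_inv_T by auto
      moreover from this have "tau_plus l t - T \<in> {0..l T}" using tau_plus_mem_iff[of t] t by auto
      ultimately show "\<bar>final_velocity T l y (tau_plus l t - T)
          + deriv_on {0..l T} (y T) (tau_plus l t - T)\<bar>\<^sup>2 \<le> 2 * \<kappa> (l t)"
        by (intro bound) auto
    qed
  }
qed

end
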